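(* If $\Gamma\vdash_\omega M:A$ is derivable in $\Lambda_{\cap\omega}$, then $\Gamma\vdash_{s\omega} M:A$ is derivable in $\Lambda_{\cap\omega}^s$.
   Context: $\lambda$-terms: $M::=x\mid MM\mid\lambda x.M$ modulo $\alpha$-conversion; $M[x:=N]$ capture-avoiding substitution. Types: $A::=\varphi\mid\omega\mid A\to A\mid A\cap A$. A typing context is a finite set of pairs $x:A$ ($\Gamma,x:A$ denotes $\Gamma\cup\{x:A\}$; $x\notin\Gamma$ means no $x:B$ lies in $\Gamma$); in $\Lambda_{\cap\omega}$ its variables are pairwise distinct, in $\Lambda_{\cap\omega}^s$ a variable may occur with several types. $\Lambda_{\cap\omega}$: (Ax) $\Gamma,x:A\vdash_\omega x:A$; ($\to$I) from $\Gamma,x:A\vdash_\omega M:B$, $x\notin\Gamma$, infer $\Gamma\vdash_\omega\lambda x.M:A\to B$; ($\to$E) from $\Gamma\vdash_\omega M:A\to B$ and $\Gamma\vdash_\omega N:A$ infer $\Gamma\vdash_\omega MN:B$; ($\cap$I) from $\Gamma\vdash_\omega M:A$, $\Gamma\vdash_\omega M:B$ infer $\Gamma\vdash_\omega M:A\cap B$; ($\cap$E) from $\Gamma\vdash_\omega M:A\cap B$ infer $\Gamma\vdash_\omega M:A$ and $\Gamma\vdash_\omega M:B$; $(\omega)$ $\Gamma\vdash_\omega M:\omega$. $\Lambda_{\cap\omega}^s$ ($n\ge0$): (Ax) $\Gamma,x:A\vdash_{s\omega} x:A$; $(\mathsf{Beta})^s$ from $\Gamma\vdash_{s\omega} M[x:=N]N_1\dots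 N_n:A$ and $\Gamma\vdash_{s\omega} N:B$ infer $\Gamma\vdash_{s\omega}(\lambda x.M)NN_1\dots N_n:A$; $(\mathsf{L}\to)$ from $\Gamma\vdash_{s\omega} N:A_1$ and $\Gamma,y:A_2\vdash_{s\omega} yN_1\dots N_n:B$, with $y\notin FV(N_1)\cup\dots\cup FV(N_n)$, $y\notin\Gamma$, infer $\Gamma,x:A_1\to A_2\vdash_{s\omega} xNN_1\dots N_n:B$; $(\mathsf{R}\to)$ from $\Gamma,x:A\vdash_{s\omega} M:B$, $x\notin\Gamma$, infer $\Gamma\vdash_{s\omega}\lambda x.M:A\to B$; $(\mathsf{L}\cap)$ from $\Gamma,x:A_1,x:A_2\vdash_{s\omega} xN_1\dots N_n:B$ infer $\Gamma,x:A_1\cap A_2\vdash_{s\omega} xN_1\dots N_n:B$; $(\mathsf{R}\cap)$ from $\Gamma\vdash_{s\omega} M:A$ and $\Gamma\vdash_{s\omega} M:B$ infer $\Gamma\vdash_{s\omega} M:A\cap B$; $(\omega)$ $\Gamma\vdash_{s\omega} M:\omega$. *)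

theory Defs
  imports Main "HOL-Library.FSet"
begin

section \<open>Lambda-terms modulo alpha-conversion\<close>

text \<open>
  Alpha-equivalence classes are represented by locally closed locally nameless terms: free
  variables are names, bound variables are indices. From \<open>lterm\<close> onwards only names are visible,
  and \<open>lam x M\<close> is the alpha-class of the abstraction of the name \<open>x\<close> in \<open>M\<close>. The lemmas below
  (generation, freeness up to alpha, equations for free variables and for substitution)
  characterise \<open>lterm\<close> as the type of named terms modulo alpha.
\<close>

type_synonym name = nat

datatype pre = BVar nat | FVar name | PApp pre pre | PAbs pre

primrec lc_at :: "nat \<Rightarrow> pre \<Rightarrow> bool" where
  "lc_at k (BVar i) = (i < k)"
| "lc_at k (FVar x) = True"
| "lc_at k (PApp t u) = (lc_at k t \<and> lc_at k u)"
| "lc_at k (PAbs t) = lc_at (Suc k) t"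

primrec pclose :: "nat \<Rightarrow> name \<Rightarrow> pre \<Rightarrow> pre" where
  "pclose k x (BVar i) = BVar i"
| "pclose k x (FVar y) = (if y = x then BVar k else FVar y)"
| "pclose k x (PApp t u) = PApp (pclose k x t) (pclose k x u)"
| "pclose k x (PAbs t) = PAbs (pclose (Suc k) x t)"

primrec pfv :: "pre \<Rightarrow> name set" where
  "pfv (BVar i) = {}"
| "pfv (FVar x) = {x}"
| "pfv (PApp t u) = pfv t \<union> pfv u"
| "pfv (PAbs t) = pfv t"

primrec psubst :: "pre \<Rightarrow> name \<Rightarrow> pre \<Rightarrow> pre" where
  "psubst (BVar i) x s = BVar i"
| "psubst (FVar y) x s = (if y = x then s else FVar y)"
| "psubst (PApp t u) x s = PApp (psubst t x s) (psubst u x s)"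
| "psubst (PAbs t) x s = PAbs (psubst t x s)"

lemma lc_at_mono: "lc_at k t \<Longrightarrow> k \<le> l \<Longrightarrow> lc_at l t"
  by (induction t arbitrary: k l) force+

lemma lc_at_pclose: "lc_at k t \<Longrightarrow> lc_at (Suc k) (pclose k x t)"
  by (induction t arbitrary: k) auto

lemma lc_at_psubst: "lc_at k t \<Longrightarrow> lc_at 0 s \<Longrightarrow> lc_at k (psubst t x s)"
  by (induction t arbitrary: k) (auto intro: lc_at_mono)

typedef lterm = "{t. lc_at 0 t}"
  by (rule exI[of _ "FVar 0"]) simp

setup_lifting type_definition_lterm

lift_definition Var :: "name \<Rightarrow> lterm" is FVar by simp

lift_definition App :: "lterm \<Rightarrow> lterm \<Rightarrow> lterm" is PApp by simp

lift_definition lam :: "name \<Rightarrow> lterm \<Rightarrow> lterm" is "\<lambda>x t. PAbs (pclose 0 x t)"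
  by (simp add: lc_at_pclose)

lift_definition FV :: "lterm \<Rightarrow> name set" is pfv .

lift_definition subst :: "lterm \<Rightarrow> name \<Rightarrow> lterm \<Rightarrow> lterm"  ("_[_::=_]" [100, 0, 0] 100) is psubst
  by (rule lc_at_psubst)

text \<open>\<open>apps M [N\<^sub>1, \<dots>, N\<^sub>n]\<close> is \<open>M N\<^sub>1 \<dots> N\<^sub>n\<close>.\<close>

definition apps :: "lterm \<Rightarrow> lterm list \<Rightarrow> lterm" where
  "apps M Ns = foldl App M Ns"


subsection \<open>Adequacy of the representation\<close>

primrec popen :: "nat \<Rightarrow> name \<Rightarrow> pre \<Rightarrow> pre" where
  "popen k x (BVar i) = (if i = k then FVar x else BVar i)"
| "popen k x (FVar y) = FVar y"
| "popen k x (PApp t u) = PApp (popen k x t) (popen k x u)"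
| "popen k x (PAbs t) = PAbs (popen (Suc k) x t)"

lemma finite_pfv: "finite (pfv t)"
  by (induction t) auto

lemma lc_at_popen: "lc_at (Suc k) t \<Longrightarrow> lc_at k (popen k x t)"
  by (induction t arbitrary: k) auto

lemma size_popen: "size (popen k x t) = size t"
  by (induction t arbitrary: k) auto

lemma pclose_popen: "x \<notin> pfv t \<Longrightarrow> pclose k x (popen k x t) = t"
  by (induction t arbitrary: k) auto

lemma popen_pclose: "lc_at k t \<Longrightarrow> popen k y (pclose k x t) = psubst t x (FVar y)"
  by (induction t arbitrary: k) auto

lemma pclose_rename:
  "y = x \<or> y \<notin> pfv t \<Longrightarrow> pclose k y (psubst t x (FVar y)) = pclose k x t"
  by (induction t arbitrary: k) auto

lemma pfv_pclose: "pfv (pclose k x t) = pfv t - {x}"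
  by (induction t arbitrary: k) auto

lemma psubst_id: "psubst t x (FVar x) = t"
  by (induction t) auto

lemma psubst_fresh: "x \<notin> pfv t \<Longrightarrow> psubst t x s = t"
  by (induction t) auto

lemma pclose_fresh: "x \<notin> pfv t \<Longrightarrow> pclose k x t = t"
  by (induction t arbitrary: k) auto

lemma psubst_pclose:
  "y \<noteq> x \<Longrightarrow> y \<notin> pfv s \<Longrightarrow> psubst (pclose k y t) x s = pclose k y (psubst t x s)"
  by (induction t arbitrary: k) (auto simp: pclose_fresh)

lemma lterm_induct [case_names Var App lam]:
  assumes "\<And>x. P (Var x)"
    and "\<And>M N. P M \<Longrightarrow> P N \<Longrightarrow> P (App M N)"
    and "\<And>x M. P M \<Longrightarrow> P (lam x M)"
  shows "P M"
proof -
  have "P (Abs_lterm t)" if "lc_at 0 t" for t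
    using that
  proof (induction t rule: measure_induct_rule[of size])
    case (less t)
    show ?case
    proof (cases t)
      case (BVar i)
      then show ?thesis using less.prems by simp
    next
      case (FVar x)
      then show ?thesis using assms(1)[of x] by (simp add: Var_def)
    next
      case (PApp u v)
      then have lc: "lc_at 0 u" "lc_at 0 v" using less.prems by auto
      then have "App (Abs_lterm u) (Abs_lterm v) = Abs_lterm t"
        using PApp by (simp add: App_def Abs_lterm_inverse)
      moreover have "P (Abs_lterm u)" "P (Abs_lterm v)"
        using less.IH lc PApp by auto
      ultimately show ?thesis using assms(2) by metis
    next
      case (PAbs u)
      obtain x where x: "x \<notin> pfv u"
        using ex_new_if_finite[OF infinite_UNIV_nat finite_pfv] by blast
      have lc: "lc_at 0 (popen 0 x u)"
        using less.prems PAbs by (simp add: lc_at_popen)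
      then have "lam x (Abs_lterm (popen 0 x u)) = Abs_lterm t"
        using x PAbs by (simp add: lam_def Abs_lterm_inverse pclose_popen)
      moreover have "P (Abs_lterm (popen 0 x u))"
        using less.IH lc PAbs by (simp add: size_popen)
      ultimately show ?thesis using assms(3) by metis
    qed
  qed
  then show ?thesis
    by (metis Rep_lterm Rep_lterm_inverse mem_Collect_eq)
qed

lemma lterm_inject:
  "Var x = Var y \<longleftrightarrow> x = y"
  "App M N = App M' N' \<longleftrightarrow> M = M' \<and> N = N'"
  by (transfer; simp)+

lemma lterm_distinct:
  "Var x \<noteq> App M N" "Var x \<noteq> lam y M" "App M N \<noteq> lam y M'"
  by (transfer; simp)+

text \<open>Abstractions are equal exactly when they are alpha-convertible.\<close>

lemma lam_eq_iff: "lam x M = lam y N \<longleftrightarrow> (y = x \<or> y \<notin> FV M) \<and> N = M[x::=Var y]"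
proof transfer
  fix x y and t u :: pre
  assume lc: "lc_at 0 t" "lc_at 0 u"
  show "PAbs (pclose 0 x t) = PAbs (pclose 0 y u) \<longleftrightarrow>
    (y = x \<or> y \<notin> pfv t) \<and> u = psubst t x (FVar y)"
  proof
    assume "PAbs (pclose 0 x t) = PAbs (pclose 0 y u)"
    then have eq: "pclose 0 x t = pclose 0 y u" by simp
    have "pfv t - {x} = pfv u - {y}"
      using eq by (metis pfv_pclose)
    moreover have "u = psubst t x (FVar y)"
      using eq lc by (metis popen_pclose psubst_id)
    ultimately show "(y = x \<or> y \<notin> pfv t) \<and> u = psubst t x (FVar y)" by blast
  qed (auto simp: pclose_rename)
qed

lemma FV_simps:
  "FV (Var x) = {x}" "FV (App M N) = FV M \<union> FV N" "FV (lam x M) = FV M - {x}"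
  by (transfer; simp add: pfv_pclose)+

lemma subst_simps:
  "(Var y)[x::=N] = (if y = x then N else Var y)"
  "(App M M')[x::=N] = App (M[x::=N]) (M'[x::=N])"
  "(lam x M)[x::=N] = lam x M"
  "y \<noteq> x \<Longrightarrow> y \<notin> FV N \<Longrightarrow> (lam y M)[x::=N] = lam y (M[x::=N])"
  by (transfer; simp add: psubst_fresh pfv_pclose psubst_pclose)+


section \<open>Types and typing contexts\<close>

datatype 'a ty =
    Atom 'a
  | Omega  ("\<omega>")
  | Arrow "'a ty" "'a ty"  (infixr "\<rightarrow>" 65)
  | Inter "'a ty" "'a ty"  (infixr "\<^bold>\<inter>" 70)

type_synonym 'a ctx = "(name \<times> 'a ty) fset"

text \<open>\<open>x |\<notin>| cdom \<Gamma>\<close> is the paper's \<open>x \<notin> \<Gamma>\<close>; \<open>\<Gamma>, x:A\<close> is \<open>finsert (x, A) \<Gamma>\<close>.\<close>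

definition cdom :: "'a ctx \<Rightarrow> name fset" where
  "cdom \<Gamma> = fst |`| \<Gamma>"

definition distinct_vars :: "'a ctx \<Rightarrow> bool" where
  "distinct_vars \<Gamma> \<longleftrightarrow> (\<forall>x A B. (x, A) |\<in>| \<Gamma> \<and> (x, B) |\<in>| \<Gamma> \<longrightarrow> A = B)"


section \<open>The natural deduction system\<close>

text \<open>
  Contexts must have pairwise distinct variables. It suffices to demand this at the leaves of a
  derivation, see \<open>nd_typ_distinct_vars\<close> below.
\<close>

inductive nd_typ :: "'a ctx \<Rightarrow> lterm \<Rightarrow> 'a ty \<Rightarrow> bool"  ("_ \<turnstile>\<^sub>\<omega> _ \<^bold>: _" [50, 50, 50] 50) where
  Ax: "distinct_vars (finsert (x, A) \<Gamma>) \<Longrightarrow> finsert (x, A) \<Gamma> \<turnstile>\<^sub>\<omega> Var x \<^bold>: A"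
| ArrI: "finsert (x, A) \<Gamma> \<turnstile>\<^sub>\<omega> M \<^bold>: B \<Longrightarrow> x |\<notin>| cdom \<Gamma> \<Longrightarrow> \<Gamma> \<turnstile>\<^sub>\<omega> lam x M \<^bold>: A \<rightarrow> B"
| ArrE: "\<Gamma> \<turnstile>\<^sub>\<omega> M \<^bold>: A \<rightarrow> B \<Longrightarrow> \<Gamma> \<turnstile>\<^sub>\<omega> N \<^bold>: A \<Longrightarrow> \<Gamma> \<turnstile>\<^sub>\<omega> App M N \<^bold>: B"
| IntI: "\<Gamma> \<turnstile>\<^sub>\<omega> M \<^bold>: A \<Longrightarrow> \<Gamma> \<turnstile>\<^sub>\<omega> M \<^bold>: B \<Longrightarrow> \<Gamma> \<turnstile>\<^sub>\<omega> M \<^bold>: A \<^bold>\<inter> B"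
| IntE1: "\<Gamma> \<turnstile>\<^sub>\<omega> M \<^bold>: A \<^bold>\<inter> B \<Longrightarrow> \<Gamma> \<turnstile>\<^sub>\<omega> M \<^bold>: A"
| IntE2: "\<Gamma> \<turnstile>\<^sub>\<omega> M \<^bold>: A \<^bold>\<inter> B \<Longrightarrow> \<Gamma> \<turnstile>\<^sub>\<omega> M \<^bold>: B"
| Om: "distinct_vars \<Gamma> \<Longrightarrow> \<Gamma> \<turnstile>\<^sub>\<omega> M \<^bold>: \<omega>"

lemma nd_typ_distinct_vars: "\<Gamma> \<turnstile>\<^sub>\<omega> M \<^bold>: A \<Longrightarrow> distinct_vars \<Gamma>"
  by (induction rule: nd_typ.induct) (auto simp: distinct_vars_def)


section \<open>The sequent-style system\<close>

inductive seq_typ :: "'a ctx \<Rightarrow> lterm \<Rightarrow> 'a ty \<Rightarrow> bool"  ("_ \<turnstile>\<^sub>s\<^sub>\<omega> _ \<^bold>: _" [50, 50, 50] 50) where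
  Ax: "finsert (x, A) \<Gamma> \<turnstile>\<^sub>s\<^sub>\<omega> Var x \<^bold>: A"
| Beta: "\<Gamma> \<turnstile>\<^sub>s\<^sub>\<omega> apps (M[x::=N]) Ns \<^bold>: A \<Longrightarrow> \<Gamma> \<turnstile>\<^sub>s\<^sub>\<omega> N \<^bold>: B \<Longrightarrow>
    \<Gamma> \<turnstile>\<^sub>s\<^sub>\<omega> apps (App (lam x M) N) Ns \<^bold>: A"
| LArr: "\<Gamma> \<turnstile>\<^sub>s\<^sub>\<omega> N \<^bold>: A\<^sub>1 \<Longrightarrow> finsert (y, A\<^sub>2) \<Gamma> \<turnstile>\<^sub>s\<^sub>\<omega> apps (Var y) Ns \<^bold>: B \<Longrightarrow>
    \<forall>N' \<in> set Ns. y \<notin> FV N' \<Longrightarrow> y |\<notin>| cdom \<Gamma> \<Longrightarrow>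
    finsert (x, A\<^sub>1 \<rightarrow> A\<^sub>2) \<Gamma> \<turnstile>\<^sub>s\<^sub>\<omega> apps (App (Var x) N) Ns \<^bold>: B"
| RArr: "finsert (x, A) \<Gamma> \<turnstile>\<^sub>s\<^sub>\<omega> M \<^bold>: B \<Longrightarrow> x |\<notin>| cdom \<Gamma> \<Longrightarrow> \<Gamma> \<turnstile>\<^sub>s\<^sub>\<omega> lam x M \<^bold>: A \<rightarrow> B"
| LInt: "finsert (x, A\<^sub>1) (finsert (x, A\<^sub>2) \<Gamma>) \<turnstile>\<^sub>s\<^sub>\<omega> apps (Var x) Ns \<^bold>: B \<Longrightarrow>
    finsert (x, A\<^sub>1 \<^bold>\<inter> A\<^sub>2) \<Gamma> \<turnstile>\<^sub>s\<^sub>\<omega> apps (Var x) Ns \<^bold>: B"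
| RInt: "\<Gamma> \<turnstile>\<^sub>s\<^sub>\<omega> M \<^bold>: A \<Longrightarrow> \<Gamma> \<turnstile>\<^sub>s\<^sub>\<omega> M \<^bold>: B \<Longrightarrow> \<Gamma> \<turnstile>\<^sub>s\<^sub>\<omega> M \<^bold>: A \<^bold>\<inter> B"
| Om: "\<Gamma> \<turnstile>\<^sub>s\<^sub>\<omega> M \<^bold>: \<omega>"

end

theory Submission
  imports Defs
begin

text \<open>
  Types are interpreted as Kripke predicates on pairs of a context and a term (\<open>red\<close>), where the
  arrow clause also demands derivability in the sequent system: without it, reification would need
  an \<open>\<eta>\<close>-rule. The predicates are closed under weak head expansion by \<open>Beta\<close> (whose side premise is
  discharged with type \<open>\<omega>\<close>). A term \<open>M\<close> is neutral at \<open>A\<close> if any derivation about \<open>y N\<^sub>1 \<dots> N\<^sub>n\<close>, with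
  \<open>y : A\<close> fresh, yields one about \<open>M N\<^sub>1 \<dots> N\<^sub>n\<close>; the left rules say exactly that neutral terms are
  stable under the elimination rules, hence neutral terms are reducible. Every term typable in
  natural deduction is reducible, hence derivable in the sequent system.
\<close>

section \<open>Parallel substitution\<close>

text \<open>Values are meant to be locally closed, so nothing is shifted under
  \<open>PAbs\<close>.\<close>

primrec pmsubst :: "(name \<Rightarrow> pre) \<Rightarrow> pre \<Rightarrow> pre" where
  "pmsubst \<sigma> (BVar i) = BVar i"
| "pmsubst \<sigma> (FVar y) = \<sigma> y"
| "pmsubst \<sigma> (PApp t u) = PApp (pmsubst \<sigma> t) (pmsubst \<sigma> u)"
| "pmsubst \<sigma> (PAbs t) = PAbs (pmsubst \<sigma> t)"

lemma lc_at_pmsubst: "lc_at k t \<Longrightarrow> (\<And>x. lc_at 0 (\<sigma> x)) \<Longrightarrow> lc_at k (pmsubst \<sigma> t)"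
  by (induction t arbitrary: k) (auto intro: lc_at_mono)

lemma pmsubst_cong: "(\<And>x. x \<in> pfv t \<Longrightarrow> \<sigma> x = \<tau> x) \<Longrightarrow> pmsubst \<sigma> t = pmsubst \<tau> t"
  by (induction t) auto

lemma pmsubst_pmsubst: "pmsubst \<tau> (pmsubst \<sigma> t) = pmsubst (\<lambda>x. pmsubst \<tau> (\<sigma> x)) t"
  by (induction t) auto

lemma pmsubst_FVar: "pmsubst FVar t = t"
  by (induction t) auto

lemma psubst_conv_pmsubst: "psubst t x s = pmsubst (FVar(x := s)) t"
  by (induction t) auto

text \<open>Sending \<open>x\<close> to \<open>FVar z\<close> and closing at \<open>z\<close>
  captures exactly the old occurrences of \<open>x\<close>: by freshness no other \<sigma>
  \<open>y\<close> contributes a \<open>z\<close>.\<close>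

lemma pmsubst_pclose:
  "(\<And>y. y \<in> pfv t - {x} \<Longrightarrow> z \<notin> pfv (\<sigma> y)) \<Longrightarrow>
    pmsubst \<sigma> (pclose k x t) = pclose k z (pmsubst (\<sigma>(x := FVar z)) t)"
  by (induction t arbitrary: k) (auto simp: pclose_fresh)

lift_definition msubst :: "(name \<Rightarrow> lterm) \<Rightarrow> lterm \<Rightarrow> lterm" is pmsubst
  by (simp add: lc_at_pmsubst)

lemma msubst_simps [simp]:
  "msubst \<sigma> (Var x) = \<sigma> x"
  "msubst \<sigma> (App M N) = App (msubst \<sigma> M) (msubst \<sigma> N)"
  by (transfer; simp)+

lemma msubst_lam:
  assumes "\<And>y. y \<in> FV M - {x} \<Longrightarrow> z \<notin> FV (\<sigma> y)"
  shows "msubst \<sigma> (lam x M) = lam z (msubst (\<sigma>(x := Var z)) M)"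
  using assms by transfer (simp, rule pmsubst_pclose, blast)

lemma msubst_cong: "(\<And>x. x \<in> FV M \<Longrightarrow> \<sigma> x = \<tau> x) \<Longrightarrow> msubst \<sigma> M = msubst \<tau> M"
  by transfer (rule pmsubst_cong)

lemma msubst_msubst: "msubst \<tau> (msubst \<sigma> M) = msubst (\<lambda>x. msubst \<tau> (\<sigma> x)) M"
  by transfer (rule pmsubst_pmsubst)

lemma msubst_Var [simp]: "msubst Var M = M"
  by transfer (rule pmsubst_FVar)

lemma subst_conv_msubst: "M[x::=N] = msubst (Var(x := N)) M"
  by transfer (rule psubst_conv_pmsubst)

lemma finite_FV [simp]: "finite (FV M)"
  by transfer (rule finite_pfv)

text \<open>Composing the substitutions, \<open>[z::=N]\<close> fixes each other \<sigma>
  \<open>y\<close> by freshness and turns the value \<open>Var z\<close> of \<open>x\<close> into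
  \<open>N\<close>. This computes the contractum of a redex whose bound name was changed to
  \<open>z\<close>.\<close>

lemma subst_msubst_fresh:
  assumes "\<And>y. y \<in> FV M - {x} \<Longrightarrow> z \<notin> FV (\<sigma> y)"
  shows "(msubst (\<sigma>(x := Var z)) M)[z::=N] = msubst (\<sigma>(x := N)) M"
proof -
  have "msubst (Var(z := N)) (\<sigma> y) = \<sigma> y" if "y \<in> FV M - {x}" for y
  proof -
    have "msubst (Var(z := N)) (\<sigma> y) = msubst Var (\<sigma> y)"
      using assms[OF that] by (intro msubst_cong) auto
    then show ?thesis by simp
  qed
  then show ?thesis
    unfolding subst_conv_msubst msubst_msubst by (intro msubst_cong) auto
qed

lemma msubst_subst: "msubst \<sigma> (M[x::=N]) = msubst (\<sigma>(x := msubst \<sigma> N)) M"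
  unfolding subst_conv_msubst msubst_msubst by (rule msubst_cong) simp

section \<open>Application spines and fresh names\<close>

lemma apps_simps [simp]:
  "apps M [] = M"
  "apps M (N # Ns) = apps (App M N) Ns"
  by (simp_all add: apps_def)

lemma apps_snoc: "apps M (Ns @ [N]) = App (apps M Ns) N"
  by (simp add: apps_def)

lemma msubst_apps [simp]: "msubst \<sigma> (apps M Ns) = apps (msubst \<sigma> M) (map (msubst \<sigma>) Ns)"
  by (induction Ns arbitrary: M) simp_all

lemma mem_cdom_iff: "x |\<in>| cdom \<Gamma> \<longleftrightarrow> (\<exists>A. (x, A) |\<in>| \<Gamma>)"
  unfolding cdom_def by force

lemma obtain_fresh:
  fixes \<Gamma> :: "'a ctx"
  assumes "finite X"
  obtains z where "z |\<notin>| cdom \<Gamma>" "z \<notin> X"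
proof -
  obtain z where "z \<notin> fset (cdom \<Gamma>) \<union> X"
    using ex_new_if_finite[OF infinite_UNIV_nat] assms by (metis finite_UnI finite_fset)
  then show thesis using that by auto
qed

section \<open>Renaming and weakening in the sequent system\<close>

text \<open>The renaming need not be injective, so that this covers contraction as well as weakening.\<close>

lemma seq_typ_rename:
  assumes "\<Gamma> \<turnstile>\<^sub>s\<^sub>\<omega> M \<^bold>: A"
    and "\<And>x B. (x, B) |\<in>| \<Gamma> \<Longrightarrow> (f x, B) |\<in>| \<Delta>"
  shows "\<Delta> \<turnstile>\<^sub>s\<^sub>\<omega> msubst (\<lambda>x. Var (f x)) M \<^bold>: A"
  using assms
proof (induction arbitrary: f \<Delta> rule: seq_typ.induct)
  case (Ax x A \<Gamma>)
  \<comment> \<open>The renamed declaration already lies in \<Delta>, so the rule concludes in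
    \<Delta> itself; the left rules below use the same absorption.\<close>
  then have "finsert (f x, A) \<Delta> = \<Delta>" by auto
  then show ?case using seq_typ.Ax[of "f x" A \<Delta>] by simp
next
  case (Beta \<Gamma> M x N Ns A B)
  let ?\<sigma> = "\<lambda>x. Var (f x)"
  \<comment> \<open>The bound name has to change, since \<open>f\<close> may send another free
    variable of \<open>M\<close> to \<open>x\<close>.\<close>
  obtain z where "z \<notin> f ` FV M"
    using ex_new_if_finite[OF infinite_UNIV_nat, of "f ` FV M"] by auto
  then have z: "z \<notin> FV (?\<sigma> y)" if "y \<in> FV M - {x}" for y
    using that by (auto simp: FV_simps)
  have "\<Delta> \<turnstile>\<^sub>s\<^sub>\<omega> apps ((msubst (?\<sigma>(x := Var z)) M)[z::=msubst ?\<sigma> N]) (map (msubst ?\<sigma>) Ns) \<^bold>: A"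
    using Beta.IH(1)[of f \<Delta>] Beta.prems subst_msubst_fresh[OF z] by (simp add: msubst_subst)
  from seq_typ.Beta[OF this Beta.IH(2)[of f \<Delta>, OF Beta.prems]] show ?case
    using msubst_lam[OF z] by simp
next
  case (LArr \<Gamma> N A\<^sub>1 y A\<^sub>2 Ns B x)
  let ?\<sigma> = "\<lambda>x. Var (f x)"
  \<comment> \<open>The name \<open>y\<close> may be declared in \<Delta>, so the induction
    hypothesis is taken at \<open>f(y := z)\<close>; this leaves the arguments alone, as
    \<open>y\<close> is not free in them.\<close>
  obtain z where z: "z |\<notin>| cdom \<Delta>" "z \<notin> (\<Union>N' \<in> set Ns. FV (msubst ?\<sigma> N'))"
    by (rule obtain_fresh[of "\<Union>N' \<in> set Ns. FV (msubst ?\<sigma> N')" \<Delta>]) auto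
  have Ns: "map (msubst (\<lambda>v. Var ((f(y := z)) v))) Ns = map (msubst ?\<sigma>) Ns"
    using LArr.hyps(3) by (intro map_cong refl msubst_cong) auto
  have "finsert (z, A\<^sub>2) \<Delta> \<turnstile>\<^sub>s\<^sub>\<omega> msubst (\<lambda>v. Var ((f(y := z)) v)) (apps (Var y) Ns) \<^bold>: B"
    using LArr.prems LArr.hyps(4) by (intro LArr.IH(2)) (auto simp: mem_cdom_iff)
  then have "finsert (z, A\<^sub>2) \<Delta> \<turnstile>\<^sub>s\<^sub>\<omega> apps (Var z) (map (msubst ?\<sigma>) Ns) \<^bold>: B"
    by (simp only: msubst_apps Ns) simp
  moreover have "\<Delta> \<turnstile>\<^sub>s\<^sub>\<omega> msubst ?\<sigma> N \<^bold>: A\<^sub>1"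
    using LArr.prems by (intro LArr.IH(1)) auto
  moreover have "finsert (f x, A\<^sub>1 \<rightarrow> A\<^sub>2) \<Delta> = \<Delta>"
    using LArr.prems by auto
  ultimately show ?case
    using seq_typ.LArr[of \<Delta> "msubst ?\<sigma> N" A\<^sub>1 z A\<^sub>2 "map (msubst ?\<sigma>) Ns" B "f x"] z by simp
next
  case (RArr x A \<Gamma> M B)
  obtain z where z: "z |\<notin>| cdom \<Delta>" "z \<notin> f ` FV M"
    by (rule obtain_fresh[of "f ` FV M" \<Delta>]) auto
  have "finsert (z, A) \<Delta> \<turnstile>\<^sub>s\<^sub>\<omega> msubst (\<lambda>v. Var ((f(x := z)) v)) M \<^bold>: B"
    using RArr.prems RArr.hyps(2) by (intro RArr.IH) (auto simp: mem_cdom_iff)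
  moreover have "(\<lambda>v. Var ((f(x := z)) v)) = (\<lambda>v. Var (f v))(x := Var z)"
    by auto
  moreover have "msubst (\<lambda>v. Var (f v)) (lam x M) = lam z (msubst ((\<lambda>v. Var (f v))(x := Var z)) M)"
    using z by (intro msubst_lam) (auto simp: FV_simps)
  ultimately show ?case using seq_typ.RArr z by metis
next
  case (LInt x A\<^sub>1 A\<^sub>2 \<Gamma> Ns B)
  have "finsert (f x, A\<^sub>1) (finsert (f x, A\<^sub>2) \<Delta>) \<turnstile>\<^sub>s\<^sub>\<omega> msubst (\<lambda>x. Var (f x)) (apps (Var x) Ns) \<^bold>: B"
    using LInt.prems by (intro LInt.IH) auto
  moreover have "finsert (f x, A\<^sub>1 \<^bold>\<inter> A\<^sub>2) \<Delta> = \<Delta>"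
    using LInt.prems by auto
  ultimately show ?case using seq_typ.LInt[of "f x" A\<^sub>1 A\<^sub>2 \<Delta>] by simp
qed (auto intro: seq_typ.RInt seq_typ.Om)

lemma seq_typ_weaken: "\<Gamma> \<turnstile>\<^sub>s\<^sub>\<omega> M \<^bold>: A \<Longrightarrow> \<Gamma> |\<subseteq>| \<Delta> \<Longrightarrow> \<Delta> \<turnstile>\<^sub>s\<^sub>\<omega> M \<^bold>: A"
  using seq_typ_rename[of \<Gamma> M A id \<Delta>] by (auto simp: fsubset_iff)

section \<open>Neutral terms\<close>

text \<open>The extensions \<Delta> build in monotonicity, and the spine \<open>Ns\<close> leaves
  room for further arguments. As \<open>y\<close> avoids \<open>Ns\<close>, only the head occurrence
  is replaced by \<open>M\<close>.\<close>

definition neutral :: "'a ctx \<Rightarrow> lterm \<Rightarrow> 'a ty \<Rightarrow> bool" where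
  "neutral \<Gamma> M A \<longleftrightarrow> (\<forall>\<Delta> y Ns C. \<Gamma> |\<subseteq>| \<Delta> \<longrightarrow> y |\<notin>| cdom \<Delta> \<longrightarrow> (\<forall>N \<in> set Ns. y \<notin> FV N) \<longrightarrow>
     finsert (y, A) \<Delta> \<turnstile>\<^sub>s\<^sub>\<omega> apps (Var y) Ns \<^bold>: C \<longrightarrow> \<Delta> \<turnstile>\<^sub>s\<^sub>\<omega> apps M Ns \<^bold>: C)"

lemma neutralI:
  assumes "\<And>\<Delta> y Ns C. \<Gamma> |\<subseteq>| \<Delta> \<Longrightarrow> y |\<notin>| cdom \<Delta> \<Longrightarrow> \<forall>N \<in> set Ns. y \<notin> FV N \<Longrightarrow>
    finsert (y, A) \<Delta> \<turnstile>\<^sub>s\<^sub>\<omega> apps (Var y) Ns \<^bold>: C \<Longrightarrow> \<Delta> \<turnstile>\<^sub>s\<^sub>\<omega> apps M Ns \<^bold>: C"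
  shows "neutral \<Gamma> M A"
  using assms unfolding neutral_def by blast

lemma neutralD:
  assumes "neutral \<Gamma> M A" "\<Gamma> |\<subseteq>| \<Delta>" "y |\<notin>| cdom \<Delta>" "\<forall>N \<in> set Ns. y \<notin> FV N"
    "finsert (y, A) \<Delta> \<turnstile>\<^sub>s\<^sub>\<omega> apps (Var y) Ns \<^bold>: C"
  shows "\<Delta> \<turnstile>\<^sub>s\<^sub>\<omega> apps M Ns \<^bold>: C"
  using assms unfolding neutral_def by blast

text \<open>The non-injective renaming of \<open>y\<close> to \<open>x\<close> contracts
  \<open>y : A\<close> into the declaration of \<open>x\<close> and fixes \<open>Ns\<close>.\<close>

lemma neutral_Var:
  assumes "(x, A) |\<in>| \<Gamma>"
  shows "neutral \<Gamma> (Var x) A"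
proof (rule neutralI)
  fix \<Delta> y Ns C
  assume *: "\<Gamma> |\<subseteq>| \<Delta>" "y |\<notin>| cdom \<Delta>" "\<forall>N \<in> set Ns. y \<notin> FV N"
    "finsert (y, A) \<Delta> \<turnstile>\<^sub>s\<^sub>\<omega> apps (Var y) Ns \<^bold>: C"
  have "\<Delta> \<turnstile>\<^sub>s\<^sub>\<omega> msubst (\<lambda>v. Var ((id(y := x)) v)) (apps (Var y) Ns) \<^bold>: C"
    using * assms by (intro seq_typ_rename[OF *(4)]) (auto simp: mem_cdom_iff)
  moreover have "map (msubst (\<lambda>v. Var ((id(y := x)) v))) Ns = map (msubst Var) Ns"
    using *(3) by (intro map_cong refl msubst_cong) auto
  ultimately show "\<Delta> \<turnstile>\<^sub>s\<^sub>\<omega> apps (Var x) Ns \<^bold>: C"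
    by (simp only: msubst_apps) (simp add: map_idI)
qed

text \<open>By \<open>LArr\<close>, a derivation for \<open>y Ns\<close> with \<open>y : B\<close>
  gives one for \<open>z N Ns\<close> with \<open>z\<close> of the arrow type; neutrality of
  \<open>M\<close> then replaces \<open>z\<close>.\<close>

lemma neutral_App:
  assumes "neutral \<Gamma> M (A \<rightarrow> B)" "\<Gamma> |\<subseteq>| \<Gamma>'" "\<Gamma>' \<turnstile>\<^sub>s\<^sub>\<omega> N \<^bold>: A"
  shows "neutral \<Gamma>' (App M N) B"
proof (rule neutralI)
  fix \<Delta> y Ns C
  assume *: "\<Gamma>' |\<subseteq>| \<Delta>" "y |\<notin>| cdom \<Delta>" "\<forall>N \<in> set Ns. y \<notin> FV N"
    "finsert (y, B) \<Delta> \<turnstile>\<^sub>s\<^sub>\<omega> apps (Var y) Ns \<^bold>: C"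
  \<comment> \<open>Freshness for \<open>N\<close> matters too, since \<open>N\<close> becomes the
    first element of the spine.\<close>
  obtain z where z: "z |\<notin>| cdom \<Delta>" "z \<notin> (\<Union>N' \<in> set (N # Ns). FV N')"
    by (rule obtain_fresh[of "\<Union>N' \<in> set (N # Ns). FV N'" \<Delta>]) auto
  have "finsert (z, A \<rightarrow> B) \<Delta> \<turnstile>\<^sub>s\<^sub>\<omega> apps (Var z) (N # Ns) \<^bold>: C"
    using seq_typ.LArr[OF seq_typ_weaken[OF assms(3) *(1)] *(4,3,2)] by simp
  with z(2) have "\<Delta> \<turnstile>\<^sub>s\<^sub>\<omega> apps M (N # Ns) \<^bold>: C"
    by (intro neutralD[OF assms(1) order_trans[OF assms(2) *(1)] z(1)]) auto
  then show "\<Delta> \<turnstile>\<^sub>s\<^sub>\<omega> apps (App M N) Ns \<^bold>: C" by simp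
qed

text \<open>Weakening lets \<open>y\<close> carry both component types at once, and
  \<open>LInt\<close> merges them into the intersection.\<close>

lemma neutral_Inter:
  assumes "neutral \<Gamma> M (A \<^bold>\<inter> B)"
  shows "neutral \<Gamma> M A" "neutral \<Gamma> M B"
proof -
  have "neutral \<Gamma> M D" if D: "D = A \<or> D = B" for D
  proof (rule neutralI)
    fix \<Delta> y Ns C
    assume *: "\<Gamma> |\<subseteq>| \<Delta>" "y |\<notin>| cdom \<Delta>" "\<forall>N \<in> set Ns. y \<notin> FV N"
      "finsert (y, D) \<Delta> \<turnstile>\<^sub>s\<^sub>\<omega> apps (Var y) Ns \<^bold>: C"
    have "finsert (y, A) (finsert (y, B) \<Delta>) \<turnstile>\<^sub>s\<^sub>\<omega> apps (Var y) Ns \<^bold>: C"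
      by (rule seq_typ_weaken[OF *(4)]) (use D in auto)
    then show "\<Delta> \<turnstile>\<^sub>s\<^sub>\<omega> apps M Ns \<^bold>: C"
      by (rule neutralD[OF assms *(1-3) seq_typ.LInt])
  qed
  then show "neutral \<Gamma> M A" "neutral \<Gamma> M B" by simp_all
qed

text \<open>Neutrality is applied with the empty spine to the axiom for a fresh
  \<open>y : A\<close>.\<close>

lemma neutral_seq_typ:
  assumes "neutral \<Gamma> M A"
  shows "\<Gamma> \<turnstile>\<^sub>s\<^sub>\<omega> M \<^bold>: A"
proof -
  obtain y where "y |\<notin>| cdom \<Gamma>"
    by (rule obtain_fresh[of "{}" \<Gamma>]) auto
  then show ?thesis
    using neutralD[OF assms, of \<Gamma> y "[]" A] seq_typ.Ax[of y A \<Gamma>] by simp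
qed

section \<open>Reducibility\<close>

primrec red :: "'a ty \<Rightarrow> 'a ctx \<Rightarrow> lterm \<Rightarrow> bool" where
  "red (Atom a) \<Gamma> M \<longleftrightarrow> \<Gamma> \<turnstile>\<^sub>s\<^sub>\<omega> M \<^bold>: Atom a"
| "red \<omega> \<Gamma> M \<longleftrightarrow> True"
| "red (A \<rightarrow> B) \<Gamma> M \<longleftrightarrow> \<Gamma> \<turnstile>\<^sub>s\<^sub>\<omega> M \<^bold>: A \<rightarrow> B \<and>
    (\<forall>\<Delta> N. \<Gamma> |\<subseteq>| \<Delta> \<longrightarrow> red A \<Delta> N \<longrightarrow> red B \<Delta> (App M N))"
| "red (A \<^bold>\<inter> B) \<Gamma> M \<longleftrightarrow> red A \<Gamma> M \<and> red B \<Gamma> M"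

text \<open>Derivability is a conjunct of the arrow clause, so this can precede
  \<open>neutral_red\<close> instead of being proved simultaneously with it.\<close>

lemma red_seq_typ: "red A \<Gamma> M \<Longrightarrow> \<Gamma> \<turnstile>\<^sub>s\<^sub>\<omega> M \<^bold>: A"
  by (induction A) (auto intro: seq_typ.Om seq_typ.RInt)

lemma red_weaken: "red A \<Gamma> M \<Longrightarrow> \<Gamma> |\<subseteq>| \<Delta> \<Longrightarrow> red A \<Delta> M"
proof (induction A)
  case (Arrow A B)
  then show ?case by (simp, meson seq_typ_weaken fsubset_trans)
qed (auto intro: seq_typ_weaken)

lemma neutral_red: "neutral \<Gamma> M A \<Longrightarrow> red A \<Gamma> M"
proof (induction A arbitrary: \<Gamma> M)
  case (Arrow A B)
  then have "red B \<Delta> (App M N)" if "\<Gamma> |\<subseteq>| \<Delta>" "red A \<Delta> N" for \<Delta> N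
    using neutral_App[OF Arrow.prems that(1) red_seq_typ[OF that(2)]] by blast
  then show ?case using neutral_seq_typ[OF Arrow.prems] by simp
next
  case (Inter A B)
  then show ?case by (auto dest: neutral_Inter)
qed (auto intro: neutral_seq_typ)

lemma red_Var: "(x, A) |\<in>| \<Gamma> \<Longrightarrow> red A \<Gamma> (Var x)"
  by (intro neutral_red neutral_Var)

text \<open>The spine makes the induction on the type work: in the arrow case the new argument is
  appended to it.\<close>

lemma red_expand:
  "red A \<Gamma> (apps (M[x::=N]) Ns) \<Longrightarrow> red A \<Gamma> (apps (App (lam x M) N) Ns)"
proof (induction A arbitrary: \<Gamma> Ns)
  case (Arrow A B)
  have "red B \<Delta> (App (apps (App (lam x M) N) Ns) P)" if "\<Gamma> |\<subseteq>| \<Delta>" "red A \<Delta> P" for \<Delta> P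
    using Arrow.IH(2)[of \<Delta> "Ns @ [P]"] Arrow.prems that by (simp add: apps_snoc)
  then show ?case using Arrow.prems by (auto intro: seq_typ.Beta seq_typ.Om)
qed (auto intro: seq_typ.Beta seq_typ.Om)

text \<open>The fundamental lemma of the interpretation; substituting arbitrary reducible terms is
  what lets the induction pass under abstractions.\<close>

lemma nd_typ_red:
  assumes "\<Gamma> \<turnstile>\<^sub>\<omega> M \<^bold>: A" and "\<And>x B. (x, B) |\<in>| \<Gamma> \<Longrightarrow> red B \<Delta> (\<sigma> x)"
  shows "red A \<Delta> (msubst \<sigma> M)"
  using assms
proof (induction arbitrary: \<Delta> \<sigma> rule: nd_typ.induct)
  case (ArrI x A \<Gamma> M B)
  obtain z where z: "z |\<notin>| cdom \<Delta>" "z \<notin> (\<Union>y \<in> FV M. FV (\<sigma> y))"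
    by (rule obtain_fresh[of "\<Union>y \<in> FV M. FV (\<sigma> y)" \<Delta>]) auto
  then have fresh: "z \<notin> FV (\<sigma> y)" if "y \<in> FV M - {x}" for y
    using that by auto
  \<comment> \<open>Used twice: with \<open>N = Var z\<close> in the context extended by
    \<open>z : A\<close> it gives derivability of the abstraction, and with any reducible
    \<open>N\<close> it gives the contractum to be expanded.\<close>
  have body: "red B \<Delta>' (msubst (\<sigma>(x := N)) M)" if "\<Delta> |\<subseteq>| \<Delta>'" "red A \<Delta>' N" for \<Delta>' N
    using that ArrI.prems ArrI.hyps(2) by (intro ArrI.IH) (auto simp: mem_cdom_iff intro: red_weaken)
  have "red B (finsert (z, A) \<Delta>) (msubst (\<sigma>(x := Var z)) M)"
    by (intro body red_Var) auto
  then have "\<Delta> \<turnstile>\<^sub>s\<^sub>\<omega> lam z (msubst (\<sigma>(x := Var z)) M) \<^bold>: A \<rightarrow> B"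
    using z(1) by (intro seq_typ.RArr red_seq_typ)
  moreover have "red B \<Delta>' (App (lam z (msubst (\<sigma>(x := Var z)) M)) N)"
    if "\<Delta> |\<subseteq>| \<Delta>'" "red A \<Delta>' N" for \<Delta>' N
    using red_expand[of B \<Delta>' "msubst (\<sigma>(x := Var z)) M" z N "[]"] body[OF that]
      subst_msubst_fresh[OF fresh] by simp
  ultimately show ?case using msubst_lam[OF fresh] by simp
next
  case (ArrE \<Gamma> M A B N)
  have "red (A \<rightarrow> B) \<Delta> (msubst \<sigma> M)" "red A \<Delta> (msubst \<sigma> N)"
    using ArrE.prems by (auto intro!: ArrE.IH simp del: red.simps)
  then show ?case by auto
qed auto

theorem theorem6:
  fixes \<Gamma> :: "'a ctx" and M :: lterm and A :: "'a ty"
  assumes "\<Gamma> \<turnstile>\<^sub>\<omega> M \<^bold>: A"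
  shows "\<Gamma> \<turnstile>\<^sub>s\<^sub>\<omega> M \<^bold>: A"
proof (rule red_seq_typ)
  show "red A \<Gamma> M"
    \<comment> \<open>The identity substitution is admissible because declared variables are
      reducible.\<close>
    using nd_typ_red[OF assms, of \<Gamma> Var, OF red_Var] by simp
qed

end
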